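(* Let $\lambda,\mu$ be partitions of $2d$ all of whose parts are even. If $p_\lambda\ge p_\mu$ on $\mathbb{R}^n$ for all $n\in\mathbb{N}$, then $p_\lambda-p_\mu\in\mathbb{R}[X_1,\dots,X_n]$ is a sum of squares of polynomials for all $n\in\mathbb{N}$.
   Context: For a partition $\lambda$, $p_\lambda=\prod_i p_{\lambda_i}$ with $p_r=p_r(X_1,\dots,X_n)=X_1^r+\cdots+X_n^r$. *)

theory Defs
  imports Complex_Main "HOL-Library.Multiset" "HOL-Library.Poly_Mapping"
begin

text \<open>
  A real polynomial in the variables \<open>X\<^sub>0, X\<^sub>1, \<dots>\<close> maps each monomial to its coefficient; a
  monomial maps each variable index to its exponent. Multiplication of \<open>Poly_Mapping\<close> is
  convolution over the addition of exponents, i.e. the product of polynomials.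
\<close>

type_synonym mpoly_real = "(nat \<Rightarrow>\<^sub>0 nat) \<Rightarrow>\<^sub>0 real"

definition Var :: "nat \<Rightarrow> mpoly_real" where
  "Var i = Poly_Mapping.single (Poly_Mapping.single i 1) 1"

definition eval_monom :: "(nat \<Rightarrow>\<^sub>0 nat) \<Rightarrow> (nat \<Rightarrow> real) \<Rightarrow> real" where
  "eval_monom m x = (\<Prod>i\<in>Poly_Mapping.keys m. x i ^ Poly_Mapping.lookup m i)"

definition eval_poly :: "mpoly_real \<Rightarrow> (nat \<Rightarrow> real) \<Rightarrow> real" where
  "eval_poly p x = (\<Sum>m\<in>Poly_Mapping.keys p. Poly_Mapping.lookup p m * eval_monom m x)"

text \<open>
  The ring \<open>\<real>[X\<^sub>1, \<dots>, X\<^sub>n]\<close>, its variables being indexed by \<open>0, \<dots>, n - 1\<close>.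
\<close>

definition polys_in :: "nat \<Rightarrow> mpoly_real set" where
  "polys_in n = {p. \<forall>m\<in>Poly_Mapping.keys p. Poly_Mapping.keys m \<subseteq> {..<n}}"

text \<open>
  A point of \<open>\<real>\<^sup>n\<close> is a function on variable indices that vanishes from \<open>n\<close> onwards, as the
  dimension has to be a bound variable here.
\<close>

definition points :: "nat \<Rightarrow> (nat \<Rightarrow> real) set" where
  "points n = {x. \<forall>i\<ge>n. x i = 0}"

definition sum_of_squares_in :: "nat \<Rightarrow> mpoly_real \<Rightarrow> bool" where
  "sum_of_squares_in n f \<longleftrightarrow>
     (\<exists>(k::nat) q. (\<forall>j<k. q j \<in> polys_in n) \<and> f = (\<Sum>j<k. (q j)\<^sup>2))"

definition is_partition :: "nat multiset \<Rightarrow> nat \<Rightarrow> bool" where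
  "is_partition l m \<longleftrightarrow> 0 \<notin># l \<and> sum_mset l = m"

definition power_sum :: "nat \<Rightarrow> nat \<Rightarrow> mpoly_real" where
  "power_sum n r = (\<Sum>i<n. Var i ^ r)"

definition power_sum_partition :: "nat \<Rightarrow> nat multiset \<Rightarrow> mpoly_real" where
  "power_sum_partition n l = (\<Prod>r\<in>#l. power_sum n r)"

end

theory Submission
  imports Defs
begin

text \<open>
  Halve all parts, \<open>l = 2a\<close> and \<open>m = 2b\<close>. Evaluating at one coordinate \<open>M\<close> and \<open>M ^ (2 * t)\<close>
  coordinates \<open>1\<close> and letting \<open>M\<close> grow shows \<open>\<Sum>\<^sub>i max t b\<^sub>i \<le> \<Sum>\<^sub>i max t a\<^sub>i\<close>, that is
  \<open>\<Sum>\<^sub>i (t - b\<^sub>i)\<^sub>+ \<le> \<Sum>\<^sub>i (t - a\<^sub>i)\<^sub>+\<close>, for every \<open>t\<close>. This condition suffices to transform \<open>a\<close> into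
  \<open>b\<close> by two kinds of moves, each of which decreases the product of power sums by a sum of squares:
  while \<open>a\<close> has more parts than \<open>b\<close>, merge the two largest parts of \<open>a\<close>; when the numbers of parts
  agree, replace suitable parts \<open>r\<close> and \<open>s \<ge> r + 2\<close> by \<open>r + 1\<close> and \<open>s - 1\<close>.
\<close>

section \<open>Evaluation of polynomials\<close>

text \<open>Indices off the support contribute the factor 1, so two monomials can be evaluated over
  one common index set.\<close>

lemma eval_monom_superset:
  assumes "finite A" "Poly_Mapping.keys m \<subseteq> A"
  shows "eval_monom m x = (\<Prod>i\<in>A. x i ^ Poly_Mapping.lookup m i)"
  unfolding eval_monom_def using assms
  by (intro prod.mono_neutral_left) (auto simp: in_keys_iff)

lemma eval_monom_add: "eval_monom (m + m') x = eval_monom m x * eval_monom m' x"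
proof -
  let ?A = "Poly_Mapping.keys m \<union> Poly_Mapping.keys m'"
  have "eval_monom k x = (\<Prod>i\<in>?A. x i ^ Poly_Mapping.lookup k i)"
    if "Poly_Mapping.keys k \<subseteq> ?A" for k
    using that by (intro eval_monom_superset) auto
  then show ?thesis
    using Poly_Mapping.keys_add[of m m']
    by (simp add: lookup_add power_add prod.distrib)
qed

lemma eval_poly_superset:
  assumes "finite A" "Poly_Mapping.keys p \<subseteq> A"
  shows "eval_poly p x = (\<Sum>m\<in>A. Poly_Mapping.lookup p m * eval_monom m x)"
  unfolding eval_poly_def using assms
  by (intro sum.mono_neutral_left) (auto simp: in_keys_iff)

lemma eval_poly_add: "eval_poly (p + q) x = eval_poly p x + eval_poly q x"
proof -
  let ?A = "Poly_Mapping.keys p \<union> Poly_Mapping.keys q"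
  have "eval_poly f x = (\<Sum>m\<in>?A. Poly_Mapping.lookup f m * eval_monom m x)"
    if "Poly_Mapping.keys f \<subseteq> ?A" for f
    using that by (intro eval_poly_superset) auto
  then show ?thesis
    using Poly_Mapping.keys_add[of p q]
    by (simp add: lookup_add distrib_right sum.distrib)
qed

lemma eval_poly_zero [simp]: "eval_poly 0 x = 0"
  by (simp add: eval_poly_def)

lemma eval_poly_sum: "eval_poly (\<Sum>i\<in>A. f i) x = (\<Sum>i\<in>A. eval_poly (f i) x)"
  by (induction A rule: infinite_finite_induct) (auto simp: eval_poly_add)

lemma eval_poly_single [simp]: "eval_poly (Poly_Mapping.single m c) x = c * eval_monom m x"
  by (simp add: eval_poly_def)

lemma sum_monomials: "(\<Sum>m\<in>Poly_Mapping.keys p. Poly_Mapping.single m (Poly_Mapping.lookup p m)) = p"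
  by (rule poly_mapping_eqI) (simp add: lookup_sum lookup_single when_def in_keys_iff)

lemma eval_poly_mult: "eval_poly (p * q) x = eval_poly p x * eval_poly q x"
proof -
  let ?s = "\<lambda>p m. Poly_Mapping.single m (Poly_Mapping.lookup p m)"
  have "p * q = (\<Sum>k\<in>Poly_Mapping.keys p. ?s p k) * (\<Sum>k\<in>Poly_Mapping.keys q. ?s q k)"
    by (simp only: sum_monomials)
  also have "eval_poly \<dots> x = eval_poly p x * eval_poly q x"
    by (simp add: sum_product eval_poly_sum mult_single eval_monom_add eval_poly_def[of p]
        eval_poly_def[of q] mult_ac)
  finally show ?thesis .
qed

lemma eval_poly_one [simp]: "eval_poly 1 x = 1"
  by (simp add: eval_monom_def flip: single_one)

lemma eval_poly_power: "eval_poly (p ^ k) x = eval_poly p x ^ k"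
  by (induction k) (auto simp: eval_poly_mult)

lemma eval_poly_Var [simp]: "eval_poly (Var i) x = x i"
  by (simp add: Var_def eval_monom_def)

lemma eval_power_sum: "eval_poly (power_sum n r) x = (\<Sum>i<n. x i ^ r)"
  by (simp add: power_sum_def eval_poly_sum eval_poly_power)

lemma eval_power_sum_partition:
  "eval_poly (power_sum_partition n l) x = (\<Prod>r\<in>#l. \<Sum>i<n. x i ^ r)"
  by (induction l) (auto simp: power_sum_partition_def eval_poly_mult eval_power_sum)


section \<open>Sums of squares\<close>

lemma polys_in_diff: "p \<in> polys_in n \<Longrightarrow> q \<in> polys_in n \<Longrightarrow> p - q \<in> polys_in n"
  using keys_diff[of p q] by (fastforce simp: polys_in_def)

lemma polys_in_mult:
  assumes "p \<in> polys_in n" "q \<in> polys_in n"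
  shows "p * q \<in> polys_in n"
  unfolding polys_in_def
proof clarify
  fix m i assume "m \<in> Poly_Mapping.keys (p * q)" and i: "i \<in> Poly_Mapping.keys m"
  then obtain k k' where "m = k + k'" "k \<in> Poly_Mapping.keys p" "k' \<in> Poly_Mapping.keys q"
    using keys_mult[of p q] by blast
  then show "i < n"
    using assms i Poly_Mapping.keys_add[of k k'] by (fastforce simp: polys_in_def)
qed

lemma polys_in_one: "1 \<in> polys_in n"
  by (simp add: polys_in_def)

lemma polys_in_power: "p \<in> polys_in n \<Longrightarrow> p ^ k \<in> polys_in n"
  by (induction k) (auto simp: polys_in_one polys_in_mult)

lemma polys_in_Var: "i < n \<Longrightarrow> Var i \<in> polys_in n"
  by (simp add: polys_in_def Var_def)

lemma polys_in_mono: "k \<le> n \<Longrightarrow> polys_in k \<subseteq> polys_in n"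
  by (fastforce simp: polys_in_def)

lemma sum_of_squares_in_mono:
  "k \<le> n \<Longrightarrow> sum_of_squares_in k f \<Longrightarrow> sum_of_squares_in n f"
  unfolding sum_of_squares_in_def using polys_in_mono by blast

lemma sum_of_squares_in_zero: "sum_of_squares_in n 0"
  unfolding sum_of_squares_in_def by (rule exI[of _ 0]) auto

lemma sum_of_squares_in_square: "p \<in> polys_in n \<Longrightarrow> sum_of_squares_in n (p\<^sup>2)"
  unfolding sum_of_squares_in_def by (rule exI[of _ 1], rule exI[of _ "\<lambda>_. p"]) auto

lemma sum_of_squares_in_one: "sum_of_squares_in n 1"
  using sum_of_squares_in_square[OF polys_in_one] by simp

lemma sum_of_squares_in_add:
  assumes "sum_of_squares_in n f" "sum_of_squares_in n g"
  shows "sum_of_squares_in n (f + g)"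
proof -
  obtain k :: nat and p where p: "\<forall>j<k. p j \<in> polys_in n" "f = (\<Sum>j<k. (p j)\<^sup>2)"
    using assms(1) unfolding sum_of_squares_in_def by blast
  obtain k' :: nat and q where q: "\<forall>j<k'. q j \<in> polys_in n" "g = (\<Sum>j<k'. (q j)\<^sup>2)"
    using assms(2) unfolding sum_of_squares_in_def by blast
  define r where "r j = (if j < k then p j else q (j - k))" for j
  have "(\<Sum>j<k+k'. (r j)\<^sup>2) = (\<Sum>j<k. (r j)\<^sup>2) + (\<Sum>j<k'. (r (k + j))\<^sup>2)"
    by (induction k') (auto simp: add_ac)
  then have "f + g = (\<Sum>j<k+k'. (r j)\<^sup>2)"
    by (simp add: p q r_def)
  moreover have "\<forall>j<k+k'. r j \<in> polys_in n"
    using p q by (auto simp: r_def)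
  ultimately show ?thesis
    unfolding sum_of_squares_in_def by blast
qed

lemma sum_of_squares_in_sum:
  "(\<And>i. i \<in> A \<Longrightarrow> sum_of_squares_in n (f i)) \<Longrightarrow> sum_of_squares_in n (\<Sum>i\<in>A. f i)"
  by (induction A rule: infinite_finite_induct)
     (auto simp: sum_of_squares_in_zero sum_of_squares_in_add)

lemma sum_of_squares_in_mult:
  assumes "sum_of_squares_in n f" "sum_of_squares_in n g"
  shows "sum_of_squares_in n (f * g)"
proof -
  obtain k :: nat and p where p: "\<forall>j<k. p j \<in> polys_in n" "f = (\<Sum>j<k. (p j)\<^sup>2)"
    using assms(1) unfolding sum_of_squares_in_def by blast
  obtain k' :: nat and q where q: "\<forall>j<k'. q j \<in> polys_in n" "g = (\<Sum>j<k'. (q j)\<^sup>2)"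
    using assms(2) unfolding sum_of_squares_in_def by blast
  have "f * g = (\<Sum>i<k. \<Sum>j<k'. (p i * q j)\<^sup>2)"
    by (simp add: p q sum_product power_mult_distrib)
  then show ?thesis
    using p q by (auto intro!: sum_of_squares_in_sum sum_of_squares_in_square polys_in_mult)
qed

text \<open>The second factor is the first one times a sum of products of powers of
  \<open>u\<^sup>2\<close> and \<open>v\<^sup>2\<close>. The repeated factor and each of these
  products are squares.\<close>

lemma sum_of_squares_in_power_mult_diff:
  assumes u: "u \<in> polys_in n" and v: "v \<in> polys_in n"
  shows "sum_of_squares_in n ((u\<^sup>2 - v\<^sup>2) * ((u\<^sup>2) ^ e - (v\<^sup>2) ^ e))"
proof -
  have "(u\<^sup>2 - v\<^sup>2) * ((u\<^sup>2) ^ e - (v\<^sup>2) ^ e)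
      = (u\<^sup>2 - v\<^sup>2)\<^sup>2 * (\<Sum>i<e. (v ^ (e - Suc i) * u ^ i)\<^sup>2)"
    unfolding power_diff_sumr2[of "u\<^sup>2" e "v\<^sup>2"]
    by (simp add: power2_eq_square[of "u\<^sup>2 - v\<^sup>2"] power_mult_distrib mult.assoc
        flip: power_mult) (simp add: mult.commute)
  moreover have "sum_of_squares_in n \<dots>"
    by (intro sum_of_squares_in_mult sum_of_squares_in_sum sum_of_squares_in_square
        polys_in_diff polys_in_mult polys_in_power u v)
  ultimately show ?thesis by simp
qed


section \<open>Power sums of even degree\<close>

lemma power_sum_Suc: "power_sum (Suc n) r = power_sum n r + Var n ^ r"
  by (simp add: power_sum_def)

lemma sum_of_squares_in_power_sum: "sum_of_squares_in n (power_sum n (2 * r))"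
  unfolding power_sum_def
  by (intro sum_of_squares_in_sum)
     (auto simp: power_even_eq intro!: sum_of_squares_in_square polys_in_power polys_in_Var)

text \<open>Expanding the product, only the terms \<open>Var i ^ (2 * r) * Var j ^ (2 * s)\<close>
  with distinct i and j survive. The induction adds those that involve the new variable.\<close>

lemma sum_of_squares_in_merge:
  "sum_of_squares_in n (power_sum n (2 * r) * power_sum n (2 * s) - power_sum n (2 * (r + s)))"
proof (induction n)
  case 0
  show ?case by (simp add: power_sum_def sum_of_squares_in_zero)
next
  case (Suc n)
  let ?P = "\<lambda>r. power_sum n (2 * r)" and ?v = "Var n"
  have mono: "sum_of_squares_in (Suc n) f" if "sum_of_squares_in n f" for f
    using that sum_of_squares_in_mono[of n "Suc n"] by simp
  have sq: "sum_of_squares_in (Suc n) (?v ^ (2 * r))" for r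
    by (auto simp: power_even_eq intro!: sum_of_squares_in_square polys_in_power polys_in_Var)
  have "power_sum (Suc n) (2 * r) * power_sum (Suc n) (2 * s) - power_sum (Suc n) (2 * (r + s))
      = (?P r * ?P s - ?P (r + s)) + (?P r * ?v ^ (2 * s) + ?v ^ (2 * r) * ?P s)"
    by (simp add: power_sum_Suc algebra_simps power_add)
  also have "sum_of_squares_in (Suc n) \<dots>"
    by (intro sum_of_squares_in_add sum_of_squares_in_mult sq
        mono[OF Suc.IH] mono[OF sum_of_squares_in_power_sum])
  finally show ?case .
qed

text \<open>The diagonal terms cancel. With U and V the squares of two variables, each pair of
  variables contributes (U * V)^r * (U - V) * (U^e - V^e).\<close>

lemma sum_of_squares_in_transfer:
  "sum_of_squares_in n (power_sum n (2 * r) * power_sum n (2 * (r + e + 1))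
     - power_sum n (2 * (r + 1)) * power_sum n (2 * (r + e)))"
proof (induction n)
  case 0
  show ?case by (simp add: power_sum_def sum_of_squares_in_zero)
next
  case (Suc n)
  let ?P = "\<lambda>r. power_sum n (2 * r)" and ?V = "(Var n)\<^sup>2"
  \<comment> \<open>The contribution of the pair formed by variable i and the new variable
    n.\<close>
  let ?T = "\<lambda>i. (Var i ^ r * Var n ^ r)\<^sup>2 * (((Var i)\<^sup>2 - ?V) * (((Var i)\<^sup>2) ^ e - ?V ^ e))"
  have mono: "sum_of_squares_in (Suc n) f" if "sum_of_squares_in n f" for f
    using that sum_of_squares_in_mono[of n "Suc n"] by simp
  have P: "?P k = (\<Sum>i<n. ((Var i)\<^sup>2) ^ k)" for k
    by (simp add: power_sum_def power_mult)
  have T: "(U * V) ^ r * ((U - V) * (U ^ e - V ^ e))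
     = U ^ r * V ^ (r + e + 1) + U ^ (r + e + 1) * V ^ r
       - U ^ (r + 1) * V ^ (r + e) - U ^ (r + e) * V ^ (r + 1)" for U V :: mpoly_real
    by (simp add: algebra_simps power_add power_mult_distrib)
  have T': "?T i = ((Var i)\<^sup>2) ^ r * ?V ^ (r + e + 1) + ((Var i)\<^sup>2) ^ (r + e + 1) * ?V ^ r
       - ((Var i)\<^sup>2) ^ (r + 1) * ?V ^ (r + e) - ((Var i)\<^sup>2) ^ (r + e) * ?V ^ (r + 1)" for i
    unfolding T[symmetric] by (simp add: power_mult_distrib flip: power_mult) (simp add: mult.commute)
  have "(\<Sum>i<n. ?T i) = ?P r * ?V ^ (r + e + 1) + ?P (r + e + 1) * ?V ^ r
       - ?P (r + 1) * ?V ^ (r + e) - ?P (r + e) * ?V ^ (r + 1)"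
    unfolding T' P by (simp only: sum.distrib sum_subtractf sum_distrib_right)
  then have "power_sum (Suc n) (2 * r) * power_sum (Suc n) (2 * (r + e + 1))
     - power_sum (Suc n) (2 * (r + 1)) * power_sum (Suc n) (2 * (r + e))
     = (?P r * ?P (r + e + 1) - ?P (r + 1) * ?P (r + e)) + (\<Sum>i<n. ?T i)"
    unfolding power_sum_Suc power_mult[of "Var n"] by (simp add: algebra_simps power_add)
  moreover have "sum_of_squares_in (Suc n) \<dots>"
    by (intro sum_of_squares_in_add sum_of_squares_in_sum sum_of_squares_in_mult
        sum_of_squares_in_square sum_of_squares_in_power_mult_diff mono[OF Suc.IH]
        polys_in_power polys_in_mult polys_in_Var) auto
  ultimately show ?case by simp
qed

abbreviation even_power_sums :: "nat \<Rightarrow> nat multiset \<Rightarrow> mpoly_real" where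
  "even_power_sums n a \<equiv> power_sum_partition n (image_mset ((*) 2) a)"

lemma sum_of_squares_in_even_power_sums: "sum_of_squares_in n (even_power_sums n a)"
  by (induction a)
     (auto simp: power_sum_partition_def sum_of_squares_in_one
       intro!: sum_of_squares_in_mult sum_of_squares_in_power_sum)

lemma even_power_sums_union:
  "even_power_sums n (a + b) = even_power_sums n a * even_power_sums n b"
  by (simp add: power_sum_partition_def)

text \<open>Chains one move to the rest of the descent: the untouched parts \<open>c\<close> only
  multiply the gain of the move by a sum of squares.\<close>

lemma sum_of_squares_in_replace:
  assumes "sum_of_squares_in n (even_power_sums n a - even_power_sums n b)"
    and "sum_of_squares_in n (even_power_sums n (c + b) - f)"
  shows "sum_of_squares_in n (even_power_sums n (c + a) - f)"
proof -
  have "even_power_sums n (c + a) - f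
      = even_power_sums n c * (even_power_sums n a - even_power_sums n b)
        + (even_power_sums n (c + b) - f)"
    by (simp only: even_power_sums_union algebra_simps)
  also have "sum_of_squares_in n \<dots>"
    by (intro sum_of_squares_in_add sum_of_squares_in_mult sum_of_squares_in_even_power_sums assms)
  finally show ?thesis .
qed


section \<open>Shortfalls of multisets\<close>

text \<open>The truncated subtraction of natural numbers implements the positive part \<open>(t - r)\<^sub>+\<close>.\<close>

definition shortfall :: "nat multiset \<Rightarrow> nat \<Rightarrow> nat" where
  "shortfall a t = (\<Sum>r\<in>#a. t - r)"

lemma shortfall_empty [simp]: "shortfall {#} t = 0"
  and shortfall_add_mset [simp]: "shortfall (add_mset r a) t = (t - r) + shortfall a t"
  and shortfall_union [simp]: "shortfall (a + b) t = shortfall a t + shortfall b t"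
  by (auto simp: shortfall_def)

lemma shortfall_0 [simp]: "shortfall a 0 = 0"
  by (induction a) auto

lemma shortfall_1: "shortfall a (Suc 0) = count a 0"
  by (induction a) auto

text \<open>As a function of t, each (t - r)_+ is piecewise linear with its only kink at r, where
  the slope rises by 1. Second differences therefore recover multiplicities.\<close>

lemma shortfall_second_difference:
  "shortfall a (Suc (Suc t)) + shortfall a t = 2 * shortfall a (Suc t) + count a (Suc t)"
  by (induction a) auto

lemma shortfall_inject:
  assumes "\<And>t. shortfall a t = shortfall b t"
  shows "a = b"
proof (rule multiset_eqI)
  fix t show "count a t = count b t"
    using assms shortfall_1[of a] shortfall_1[of b]
      shortfall_second_difference[of a "t - 1"] shortfall_second_difference[of b "t - 1"]
    by (cases t) auto
qed

lemma shortfall_ge: "size a * t \<le> shortfall a t + sum_mset a"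
  by (induction a) auto

lemma shortfall_eq: "(\<And>r. r \<in># a \<Longrightarrow> r \<le> t) \<Longrightarrow> shortfall a t + sum_mset a = size a * t"
proof (induction a)
  case (add r a)
  then show ?case using add.prems[of r] by fastforce
qed simp

lemma shortfall_growth:
  "s \<le> t \<Longrightarrow> shortfall a t \<le> shortfall a s + size a * (t - s)"
  by (induction a) auto

text \<open>No part exceeds the sum, so from there on the truncation has no effect and the shortfall
  is affine with slope \<open>size a\<close>.\<close>

lemma shortfall_large:
  assumes "sum_mset a \<le> t"
  shows "shortfall a t + sum_mset a = size a * t"
proof (rule shortfall_eq)
  fix r assume "r \<in># a"
  then show "r \<le> t"
    using assms by (auto dest!: multi_member_split)
qed

text \<open>
  The excess of the shortfalls is positive strictly between two consecutive zeros \<open>r\<close> and \<open>s\<close>, so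
  its second difference at these zeros is positive, which makes \<open>r\<close> and \<open>s\<close> elements of \<open>a\<close>.
\<close>

lemma shortfall_gap:
  assumes "size a = size b" "sum_mset a = sum_mset b" "a \<noteq> b"
    and le: "\<And>t. shortfall b t \<le> shortfall a t"
  obtains c r e where "a = c + {#r, r + e + 1#}" "0 < e"
    "\<And>t. r < t \<Longrightarrow> t < r + e + 1 \<Longrightarrow> shortfall b t < shortfall a t"
proof -
  let ?Z = "\<lambda>t. shortfall b t = shortfall a t"
  obtain u where u: "\<not> ?Z u"
    using shortfall_inject assms(3) by metis
  have large: "?Z t" if "t \<ge> sum_mset a" for t
    using shortfall_large[of a t] shortfall_large[of b t] that assms by simp
  \<comment> \<open>The zeros of the excess nearest to \<open>u\<close> on either side. They exist
    because the excess vanishes at 0 and from the common sum onwards.\<close>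
  define r where "r = (GREATEST t. t \<le> u \<and> ?Z t)"
  have r: "r \<le> u \<and> ?Z r"
    unfolding r_def by (rule GreatestI_nat[of _ 0 u]) auto
  have r_max: "\<not> ?Z t" if "r < t" "t \<le> u" for t
    using Greatest_le_nat[of "\<lambda>t. t \<le> u \<and> ?Z t" t u] that unfolding r_def by auto
  define s where "s = (LEAST t. u \<le> t \<and> ?Z t)"
  have s: "u \<le> s \<and> ?Z s"
    unfolding s_def by (rule LeastI[of _ "u + sum_mset a"]) (use large in auto)
  have s_min: "\<not> ?Z t" if "t < s" "u \<le> t" for t
    using not_less_Least[of t "\<lambda>t. u \<le> t \<and> ?Z t"] that unfolding s_def by auto
  have ru: "r < u" and us: "u < s"
    using r s u by (metis le_neq_implies_less)+
  have gap: "shortfall b t < shortfall a t" if "r < t" "t < s" for t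
    using r_max[of t] s_min[of t] that le[of t] by (cases "t \<le> u") auto
  have "0 < count a r"
  proof (cases r)
    \<comment> \<open>There is no left neighbour of 0; the value at 1 is itself the multiplicity of
      0.\<close>
    case 0
    then show ?thesis
      using gap[of 1] ru us shortfall_1[of a] by (auto simp del: count_greater_zero_iff)
  next
    case (Suc k)
    then show ?thesis
      using gap[of "Suc r"] ru us r le[of k]
        shortfall_second_difference[of a k] shortfall_second_difference[of b k]
      by (auto simp del: count_greater_zero_iff)
  qed
  moreover have "0 < count a s"
  proof -
    obtain k where k: "s = Suc k" using us by (cases s) auto
    then show ?thesis
      using gap[of k] ru us s le[of "Suc s"]
        shortfall_second_difference[of a k] shortfall_second_difference[of b k]
      by (auto simp del: count_greater_zero_iff)
  qed
  ultimately have "{#r, s#} \<subseteq># a"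
    using ru us by (auto simp: insert_subset_eq_iff simp flip: count_greater_zero_iff)
  then have "a = (a - {#r, s#}) + {#r, s#}"
    by (simp only: subset_mset.diff_add)
  then show ?thesis
    \<comment> \<open>Here e = s - r - 1 is positive because \<open>u\<close> lies strictly between
      \<open>r\<close> and \<open>s\<close>.\<close>
    using that[of "a - {#r, s#}" r "s - r - 1"] gap ru us by auto
qed

section \<open>Descent by transfers and merges\<close>

lemma sum_of_squares_in_diff_same_size:
  assumes "size a = size b" "sum_mset a = sum_mset b"
    and "\<And>t. shortfall b t \<le> shortfall a t"
  shows "sum_of_squares_in n (even_power_sums n a - even_power_sums n b)"
  using assms
\<comment> \<open>A transfer lowers the sum of the squared parts by 2 * e, so the process
  terminates.\<close>
proof (induction "\<Sum>r\<in>#a. r\<^sup>2" arbitrary: a rule: less_induct)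
  case less
  show ?case
  proof (cases "a = b")
    case True
    then show ?thesis by (simp add: sum_of_squares_in_zero)
  next
    case False
    then obtain c r e where a: "a = c + {#r, r + e + 1#}" and e: "0 < e"
      and gap: "\<And>t. r < t \<Longrightarrow> t < r + e + 1 \<Longrightarrow> shortfall b t < shortfall a t"
      using shortfall_gap less.prems by metis
    let ?a' = "c + {#r + 1, r + e#}"
    \<comment> \<open>The transfer lowers the shortfall by exactly 1 for r < t < r + e + 1 and
      leaves it unchanged elsewhere; the strict inequality in the gap absorbs this loss.\<close>
    have "shortfall b t \<le> shortfall ?a' t" for t
      using gap[of t] less.prems(3)[of t] e unfolding a
      by (cases "r < t \<and> t < r + e + 1") auto
    moreover have "(\<Sum>r\<in>#?a'. r\<^sup>2) < (\<Sum>r\<in>#a. r\<^sup>2)"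
      using e unfolding a by (simp add: power2_eq_square algebra_simps)
    moreover have "size ?a' = size b" "sum_mset ?a' = sum_mset b"
      using less.prems unfolding a by auto
    ultimately have "sum_of_squares_in n (even_power_sums n ?a' - even_power_sums n b)"
      using less.hyps by blast
    moreover have "sum_of_squares_in n
        (even_power_sums n {#r, r + e + 1#} - even_power_sums n {#r + 1, r + e#})"
      using sum_of_squares_in_transfer[of n r e] by (simp add: power_sum_partition_def)
    ultimately show ?thesis
      unfolding a using sum_of_squares_in_replace by blast
  qed
qed

lemma obtain_two_largest:
  fixes a :: "nat multiset"
  assumes "2 \<le> size a"
  obtains c r s where "a = c + {#r, s#}" "r \<le> s" "\<And>x. x \<in># c \<Longrightarrow> x \<le> r"
proof -
  let ?s = "Max (set_mset a)"
  let ?a' = "a - {#?s#}"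
  let ?r = "Max (set_mset ?a')"
  have "a \<noteq> {#}" using assms by auto
  then have s: "?s \<in># a" by simp
  then have "?a' \<noteq> {#}" using assms by (auto simp: size_Diff_singleton simp flip: size_eq_0_iff_empty)
  then have r: "?r \<in># ?a'" using Max_in by blast
  show ?thesis
  proof (rule that)
    have "(?a' - {#?r#}) + {#?r, ?s#} = add_mset ?s (add_mset ?r (?a' - {#?r#}))"
      by (simp add: add_mset_commute)
    also have "\<dots> = a"
      by (simp only: insert_DiffM r s)
    finally show "a = (?a' - {#?r#}) + {#?r, ?s#}" ..
    show "?r \<le> ?s" using r by (auto dest: in_diffD)
    show "x \<le> ?r" if "x \<in># ?a' - {#?r#}" for x
      using in_diffD[OF that] by simp
  qed
qed

text \<open>Up to r, neither the two parts nor their merger contribute. Beyond r, the parts in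
  \<open>c\<close> are exhausted and its shortfall grows at the full rate \<open>size c\<close>,
  which suffices unless every part of \<open>b\<close> is at most t; in that case the sizes and the
  common sum decide.\<close>

lemma shortfall_merge_two_largest:
  assumes large: "\<And>x. x \<in># c \<Longrightarrow> x \<le> r" and "r \<le> s"
    and size: "size b < size (c + {#r, s#})" and sum: "sum_mset (c + {#r, s#}) = sum_mset b"
    and le: "\<And>t. shortfall b t \<le> shortfall (c + {#r, s#}) t"
  shows "shortfall b t \<le> shortfall (c + {#r + s#}) t"
proof (cases "t \<le> r")
  case True
  then show ?thesis using le[of t] \<open>r \<le> s\<close> by simp
next
  case False
  show ?thesis
  proof (cases "\<exists>x\<in>#b. t < x")
    case True
    then obtain x b' where x: "b = add_mset x b'" "t < x"
      by (metis multi_member_split)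
    \<comment> \<open>The part \<open>x\<close> contributes nothing up to t, so only the at most
      \<open>size c\<close> parts in \<open>b'\<close> can grow between r and t.\<close>
    have "shortfall b t = shortfall b' t" using x by simp
    also have "\<dots> \<le> shortfall b' r + size b' * (t - r)"
      using False by (intro shortfall_growth) simp
    also have "\<dots> \<le> shortfall c r + size c * (t - r)"
      using le[of r] x size \<open>r \<le> s\<close> by (intro add_mono mult_right_mono) auto
    also have "\<dots> = shortfall c t"
      using shortfall_eq[of c r] shortfall_eq[of c t] large False
      by (force simp: diff_mult_distrib2 algebra_simps dest!: order_trans[of _ r t])
    finally show ?thesis by simp
  next
    case no_larger: False
    have "shortfall b t + sum_mset b = size b * t"
      using no_larger by (intro shortfall_eq) force
    also have "\<dots> \<le> size (c + {#r + s#}) * t"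
      using size by (intro mult_right_mono) auto
    also have "\<dots> \<le> shortfall (c + {#r + s#}) t + sum_mset (c + {#r + s#})"
      by (rule shortfall_ge)
    finally show ?thesis using sum by simp
  qed
qed

lemma sum_of_squares_in_diff:
  assumes "size b \<le> size a" "sum_mset a = sum_mset b" "0 \<notin># a"
    and "\<And>t. shortfall b t \<le> shortfall a t"
  shows "sum_of_squares_in n (even_power_sums n a - even_power_sums n b)"
  using assms
proof (induction "size a" arbitrary: a rule: less_induct)
  case less
  show ?case
  proof (cases "size a = size b")
    case True
    then show ?thesis
      using less.prems by (intro sum_of_squares_in_diff_same_size) auto
  next
    case False
    \<comment> \<open>If \<open>b\<close> were empty, all parts of \<open>a\<close> would be 0,
      which \<open>0 \<notin># a\<close> excludes unless \<open>a\<close> is empty too. So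
      \<open>b\<close> has a part, and \<open>a\<close>, having more, has two to merge.\<close>
    have "b \<noteq> {#}"
    proof
      assume "b = {#}"
      then have "sum_mset a = 0" using less.prems by simp
      then have "\<forall>r\<in>#a. r = 0" by simp
      then have "a = {#}" using less.prems(3) by (metis multiset_nonemptyE)
      then show False using False \<open>b = {#}\<close> by simp
    qed
    then have "2 \<le> size a"
      using False less.prems(1) by (metis Suc_leI le_neq_implies_less less_2_cases not_le
          size_eq_0_iff_empty less_Suc0 less_nat_zero_code One_nat_def)
    then obtain c r s where a: "a = c + {#r, s#}" "r \<le> s" "\<And>x. x \<in># c \<Longrightarrow> x \<le> r"
      using obtain_two_largest by metis
    have "shortfall b t \<le> shortfall (c + {#r + s#}) t" for t
      using a less.prems False by (intro shortfall_merge_two_largest) auto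
    then have "sum_of_squares_in n (even_power_sums n (c + {#r + s#}) - even_power_sums n b)"
      using less.prems False unfolding a(1) by (intro less.hyps) (auto simp: a(1))
    moreover have "sum_of_squares_in n
        (even_power_sums n {#r, s#} - even_power_sums n {#r + s#})"
      using sum_of_squares_in_merge[of n r s] by (simp add: power_sum_partition_def)
    ultimately show ?thesis
      unfolding a(1) using sum_of_squares_in_replace by blast
  qed
qed


section \<open>Test points\<close>

text \<open>Up to a factor 2, each M^(2 * t) + M^(2 * r) is M^(2 * max r t), and max r t = r + (t -
  r)_+.\<close>

lemma prod_mset_test_bounds:
  fixes M :: real
  assumes "1 \<le> M"
  shows "M ^ (2 * (sum_mset a + shortfall a t)) \<le> (\<Prod>r\<in>#a. M ^ (2 * t) + M ^ (2 * r))"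
    and "(\<Prod>r\<in>#a. M ^ (2 * t) + M ^ (2 * r)) \<le> 2 ^ size a * M ^ (2 * (sum_mset a + shortfall a t))"
proof -
  have max: "r + (t - r) = max r t" for r by auto
  have lo: "M ^ (2 * (r + (t - r))) \<le> M ^ (2 * t) + M ^ (2 * r)" for r
    using assms unfolding max by (auto simp: max_def)
  have hi: "M ^ (2 * t) + M ^ (2 * r) \<le> 2 * M ^ (2 * (r + (t - r)))" for r
    unfolding max using power_increasing[OF _ assms, of "2 * t" "2 * max r t"]
      power_increasing[OF _ assms, of "2 * r" "2 * max r t"] by linarith
  have exp: "M ^ (2 * (sum_mset (add_mset r a) + shortfall (add_mset r a) t))
     = M ^ (2 * (r + (t - r))) * M ^ (2 * (sum_mset a + shortfall a t))" for r a
    by (simp add: algebra_simps flip: power_add)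
  show "M ^ (2 * (sum_mset a + shortfall a t)) \<le> (\<Prod>r\<in>#a. M ^ (2 * t) + M ^ (2 * r))"
  proof (induction a)
    case (add r a)
    show ?case
      unfolding exp using mult_mono[OF lo[of r] add.IH] assms by simp
  qed simp
  have nonneg: "0 \<le> (\<Prod>r\<in>#a. M ^ (2 * t) + M ^ (2 * r))" for a
    using assms by (induction a) auto
  show "(\<Prod>r\<in>#a. M ^ (2 * t) + M ^ (2 * r)) \<le> 2 ^ size a * M ^ (2 * (sum_mset a + shortfall a t))"
  proof (induction a)
    case (add r a)
    show ?case
      unfolding exp using mult_mono[OF hi[of r] add.IH _ nonneg] assms by (simp add: mult_ac)
  qed simp
qed

lemma shortfall_le_if_power_sums_le:
  assumes sum: "sum_mset a = sum_mset b"
    and le: "\<forall>n. \<forall>x\<in>points n.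
           eval_poly (even_power_sums n b) x \<le> eval_poly (even_power_sums n a) x"
  shows "shortfall b t \<le> shortfall a t"
proof (rule ccontr)
  assume contr: "\<not> ?thesis"
  \<comment> \<open>Chosen so that N^2 exceeds the constant 2^(size a) lost in the upper
    bound.\<close>
  define N :: nat where "N = 2 ^ (size a + 1)"
  \<comment> \<open>This many coordinates 1 turn the power sum of degree 2 * r into N^(2 * t) + N^(2
    * r).\<close>
  define K where "K = N ^ (2 * t)"
  define x :: "nat \<Rightarrow> real" where "x i = (if i < K then 1 else if i = K then N else 0)" for i
  let ?M = "real N" and ?k = "sum_mset a + shortfall a t"
  have M: "1 \<le> ?M" unfolding N_def by (metis of_nat_1 of_nat_le_iff one_le_numeral one_le_power)
  have "x \<in> points (Suc K)"
    by (auto simp: points_def x_def)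
  moreover have "(\<Sum>i<Suc K. x i ^ r) = ?M ^ (2 * t) + ?M ^ r" for r
    by (simp add: x_def K_def)
  then have "eval_poly (even_power_sums (Suc K) c) x = (\<Prod>r\<in>#c. ?M ^ (2 * t) + ?M ^ (2 * r))" for c
    by (simp only: eval_power_sum_partition multiset.map_comp comp_def)
  ultimately have *: "(\<Prod>r\<in>#b. ?M ^ (2 * t) + ?M ^ (2 * r)) \<le> (\<Prod>r\<in>#a. ?M ^ (2 * t) + ?M ^ (2 * r))"
    using le by metis
  \<comment> \<open>If the shortfall of \<open>b\<close> were larger, it would be so by at least 1,
    which gains a factor N^2 in the lower bound for \<open>b\<close>.\<close>
  have "?M ^ 2 * ?M ^ (2 * ?k) = ?M ^ (2 * (?k + 1))"
    by (simp flip: power_add)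
  also have "\<dots> \<le> ?M ^ (2 * (sum_mset b + shortfall b t))"
    using contr sum by (intro power_increasing M) auto
  also have "\<dots> \<le> 2 ^ size a * ?M ^ (2 * ?k)"
    using prod_mset_test_bounds[OF M] * by (meson order_trans)
  finally have "?M ^ 2 \<le> 2 ^ size a"
    using M by simp
  moreover have "?M ^ 2 = 2 ^ (size a + (size a + 2))"
    by (simp add: N_def power2_eq_square flip: power_add)
  moreover have "(2 :: real) ^ size a < 2 ^ (size a + (size a + 2))"
    by (intro power_strict_increasing) auto
  ultimately show False
    by simp
qed

section \<open>Numbers of parts, halving and conclusion\<close>

lemma size_le_if_shortfall_le:
  assumes sum: "sum_mset a = sum_mset b"
    and "\<And>t. shortfall b t \<le> shortfall a t"
  shows "size b \<le> size a"
proof -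
  \<comment> \<open>Large enough for both shortfalls to be affine with slopes the sizes; the
    successor makes it positive and thus cancellable.\<close>
  let ?t = "Suc (sum_mset a)"
  have "size b * ?t \<le> size a * ?t"
    using shortfall_large[of a ?t] shortfall_large[of b ?t] assms(2)[of ?t] sum by simp
  then show ?thesis
    by (simp only: mult_le_cancel2)
qed

lemma is_partition_halve:
  assumes "is_partition l (2 * d)" "\<forall>r\<in>#l. even r"
  obtains a where "l = image_mset ((*) 2) a" "sum_mset a = d" "0 \<notin># a"
proof
  let ?a = "image_mset (\<lambda>r. r div 2) l"
  show l: "l = image_mset ((*) 2) ?a"
    using assms(2) by (simp add: multiset.map_comp comp_def cong: image_mset_cong)
  have "2 * sum_mset ?a = sum_mset l"
    using arg_cong[OF l, of sum_mset] by (simp add: sum_mset_distrib_left multiset.map_comp comp_def)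
  then show "sum_mset ?a = d"
    using assms(1) by (simp add: is_partition_def)
  show "0 \<notin># ?a"
    using assms by (auto simp: is_partition_def elim!: evenE)
qed

theorem proposition2p15:
  fixes d :: nat and l m :: "nat multiset"
  assumes "is_partition l (2 * d)" and "is_partition m (2 * d)"
    and "\<forall>r\<in>#l. even r" and "\<forall>r\<in>#m. even r"
    and "\<forall>n. \<forall>x\<in>points n.
           eval_poly (power_sum_partition n l) x \<ge> eval_poly (power_sum_partition n m) x"
  shows "\<forall>n. sum_of_squares_in n (power_sum_partition n l - power_sum_partition n m)"
proof -
  obtain a where a: "l = image_mset ((*) 2) a" "sum_mset a = d" "0 \<notin># a"
    using is_partition_halve assms(1,3) by blast
  obtain b where b: "m = image_mset ((*) 2) b" "sum_mset b = d"
    using is_partition_halve assms(2,4) by blast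
  have "shortfall b t \<le> shortfall a t" for t
    using assms(5) a b by (intro shortfall_le_if_power_sums_le) auto
  then show ?thesis
    using a b by (auto intro!: sum_of_squares_in_diff size_le_if_shortfall_le)
qed

end
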